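(* Let $T$ be a $V$-semiring with respect to the triple $(K,v,M)$, where $K$ is a semifield and $v:K\to M_\infty$ is a surjective map (so $T=K_v$). The following statements are equivalent: (1) The valuation map $v$ has the $\min$-property; (2) For each nonnegative element $\alpha\in M$, the ideal $I_\alpha=\{x\in K_v : v(x)>\alpha\}$ of $K_v$ is subtractive; (3) The maximal ideal $P_v=\{x\in K_v : v(x)>0\}$ of $K_v$ is subtractive.
   Context: All semirings are commutative, with a zero $0$ (absorbing for multiplication) and an identity $1\neq 0$. A semifield is such a semiring in which every nonzero element is multiplicatively invertible. An ideal of a semiring $R$ is a nonempty subset $I$ closed under addition and under multiplication by elements of $R$; it is subtractive if $a+b\in I$ and $a\in I$ imply $b\in I$ for all $a,b\in R$. A tomonoid $(M,+,0,\leq)$ is a commutative monoid $(M,+,0)$ with a total order $\leq$ such that $x\leq y$ implies $x+z\leq y+z$ for all $z\in M$. For a tomonoid $M$ with no greatest element, $M_\infty = M\cup\{+\infty\}$ is the tomonoid obtained by adjoining an element $+\infty$ with $m<+\infty$ for all $m\in M$ and $m+(+\infty)=(+\infty)+m=+\infty$ for all $m\in M_\infty$. An $M$-valuation on a semiring $S$ is a map $v:S\to M_\infty$, where $M$ is a tomonoid with no greatest element, such that $v(xy)=v(x)+v(y)$ and $v(x+y)\geq\min\{v(x),v(y)\}$ for all $x,y\in S$, $v(1)=0$ and $v(0)=+\infty$. One sets $S_v=\{s\in S: v(s)\geq 0\}$, a subsemiring of $S$ (written $K_v$ when $S=K$). A semiring $T$ is a $V$-semiring with respect to the triple $(S,v,M)$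 if $v$ is an $M$-valuation on the semiring $S$, $S$ contains $T$ as a subsemiring, and $T=S_v$. An $M$-valuation $v$ on $S$ has the $\min$-property if for all $x,y\in S$, $v(x)\neq v(y)$ implies $v(x+y)=\min\{v(x),v(y)\}$. *)

theory Defs
  imports Main
begin

class semifield = comm_semiring_1 +
  assumes nonzero_invertible: "a \<noteq> 0 \<Longrightarrow> \<exists>b. a * b = 1"

class tomonoid = linorder + ordered_comm_monoid_add

datatype 'm with_infinity = Fin 'm | Infinity

instantiation with_infinity :: (linorder) linorder
begin

fun less_eq_with_infinity :: "'a with_infinity \<Rightarrow> 'a with_infinity \<Rightarrow> bool" where
  "Fin a \<le> Fin b \<longleftrightarrow> a \<le> b"
| "x \<le> Infinity \<longleftrightarrow> True"
| "Infinity \<le> Fin b \<longleftrightarrow> False"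

definition less_with_infinity :: "'a with_infinity \<Rightarrow> 'a with_infinity \<Rightarrow> bool" where
  "x < y \<longleftrightarrow> x \<le> y \<and> \<not> y \<le> (x :: 'a with_infinity)"

instance
proof
  fix x y z :: "'a with_infinity"
  show "x < y \<longleftrightarrow> x \<le> y \<and> \<not> y \<le> x"
    by (rule less_with_infinity_def)
  show "x \<le> x"
    by (cases x) auto
  show "x \<le> y \<Longrightarrow> y \<le> z \<Longrightarrow> x \<le> z"
    by (cases x; cases y; cases z) auto
  show "x \<le> y \<Longrightarrow> y \<le> x \<Longrightarrow> x = y"
    by (cases x; cases y) auto
  show "x \<le> y \<or> y \<le> x"
    by (cases x; cases y) auto
qed

end

instantiation with_infinity :: (tomonoid) tomonoid
begin

definition zero_with_infinity :: "'a with_infinity" where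
  "0 = Fin 0"

fun plus_with_infinity :: "'a with_infinity \<Rightarrow> 'a with_infinity \<Rightarrow> 'a with_infinity" where
  "Fin a + Fin b = Fin (a + b)"
| "x + Infinity = Infinity"
| "Infinity + Fin b = Infinity"

instance
proof
  fix x y z :: "'a with_infinity"
  show "(x + y) + z = x + (y + z)"
    by (cases x; cases y; cases z) (auto simp: add.assoc)
  show "x + y = y + x"
    by (cases x; cases y) (auto simp: add.commute)
  show "0 + x = x"
    by (cases x) (auto simp: zero_with_infinity_def)
  show "x \<le> y \<Longrightarrow> z + x \<le> z + y"
    by (cases x; cases y; cases z) (auto intro: add_left_mono)
qed

end

text \<open>In a total order, \<open>no_top\<close> says that there is no greatest element.\<close>

definition valuation ::
  "('s::comm_semiring_1 \<Rightarrow> 'm::{tomonoid,no_top} with_infinity) \<Rightarrow> bool" where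
  "valuation v \<longleftrightarrow>
     (\<forall>x y. v (x * y) = v x + v y) \<and>
     (\<forall>x y. v (x + y) \<ge> min (v x) (v y)) \<and>
     v 1 = 0 \<and> v 0 = Infinity"

definition valuation_semiring ::
  "('s::comm_semiring_1 \<Rightarrow> 'm::{tomonoid,no_top} with_infinity) \<Rightarrow> 's set" where
  "valuation_semiring v = {s. v s \<ge> 0}"

definition subsemiring :: "'s::comm_semiring_1 set \<Rightarrow> bool" where
  "subsemiring R \<longleftrightarrow> 0 \<in> R \<and> 1 \<in> R \<and> (\<forall>x\<in>R. \<forall>y\<in>R. x + y \<in> R \<and> x * y \<in> R)"

definition V_semiring ::
  "'s::comm_semiring_1 set \<Rightarrow> ('s \<Rightarrow> 'm::{tomonoid,no_top} with_infinity) \<Rightarrow> bool" where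
  "V_semiring T v \<longleftrightarrow> valuation v \<and> subsemiring T \<and> T = valuation_semiring v"

definition min_property ::
  "('s::comm_semiring_1 \<Rightarrow> 'm::{tomonoid,no_top} with_infinity) \<Rightarrow> bool" where
  "min_property v \<longleftrightarrow> (\<forall>x y. v x \<noteq> v y \<longrightarrow> v (x + y) = min (v x) (v y))"

text \<open>In the following, \<open>R\<close> is the carrier of a subsemiring of the ambient semiring,
  and ideals are ideals of \<open>R\<close>, not of the ambient semiring.\<close>

definition ideal_of :: "'s::comm_semiring_1 set \<Rightarrow> 's set \<Rightarrow> bool" where
  "ideal_of R I \<longleftrightarrow> I \<subseteq> R \<and> I \<noteq> {} \<and>
     (\<forall>a\<in>I. \<forall>b\<in>I. a + b \<in> I) \<and> (\<forall>r\<in>R. \<forall>a\<in>I. r * a \<in> I)"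

definition maximal_ideal_of :: "'s::comm_semiring_1 set \<Rightarrow> 's set \<Rightarrow> bool" where
  "maximal_ideal_of R I \<longleftrightarrow> ideal_of R I \<and> I \<noteq> R \<and>
     (\<forall>J. ideal_of R J \<and> I \<subseteq> J \<longrightarrow> J = I \<or> J = R)"

definition subtractive_ideal_of :: "'s::comm_semiring_1 set \<Rightarrow> 's set \<Rightarrow> bool" where
  "subtractive_ideal_of R I \<longleftrightarrow> ideal_of R I \<and>
     (\<forall>a\<in>R. \<forall>b\<in>R. a + b \<in> I \<and> a \<in> I \<longrightarrow> b \<in> I)"

definition above_ideal ::
  "('s::comm_semiring_1 \<Rightarrow> 'm::{tomonoid,no_top} with_infinity) \<Rightarrow> 'm \<Rightarrow> 's set" where
  "above_ideal v \<alpha> = {x \<in> valuation_semiring v. v x > Fin \<alpha>}"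

definition positive_ideal ::
  "('s::comm_semiring_1 \<Rightarrow> 'm::{tomonoid,no_top} with_infinity) \<Rightarrow> 's set" where
  "positive_ideal v = {x \<in> valuation_semiring v. v x > 0}"

end

theory Submission
  imports Defs
begin

text \<open>
  The elements of value \<open>0\<close> are exactly the units of the valuation semiring: a nonzero
  element of the semifield has an inverse, whose value is the negative of its own. Hence an ideal
  that is not contained in the positive ideal contains a unit, and the positive ideal is the
  greatest proper ideal (\<open>proper_ideal_subset_positive_ideal\<close>).

  If the min-property holds and \<open>a\<close> has value above \<open>\<alpha>\<close> while \<open>b\<close> does not, then \<open>a + b\<close> has
  the same value as \<open>b\<close>, so the ideals are subtractive
  (\<open>subtractive_above_ideal_if_min_property\<close>). Conversely, if \<open>v x < v y\<close> then division by \<open>x\<close>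
  turns \<open>x + y\<close> into \<open>1 + y / x\<close> with \<open>y / x\<close> of positive value. A subtractive positive ideal
  cannot contain \<open>1 + y / x\<close>, for then it would contain \<open>1\<close>; so \<open>1 + y / x\<close> has value \<open>0\<close> and
  \<open>x + y = x (1 + y / x)\<close> has value \<open>v x\<close> (\<open>min_property_if_subtractive_positive_ideal\<close>).
  The case of general \<open>\<alpha>\<close> thus reduces to \<open>\<alpha> = 0\<close>.
\<close>

lemma Infinity_greatest: "x \<le> (Infinity :: 'm::linorder with_infinity)"
  by (cases x) auto

lemma Fin_less_Infinity: "Fin a < (Infinity :: 'm::linorder with_infinity)"
  by (simp add: less_with_infinity_def)

lemma positive_ideal_eq_above_ideal_0: "positive_ideal v = above_ideal v 0"
  by (simp add: positive_ideal_def above_ideal_def zero_with_infinity_def)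

context
  fixes v :: "'s::comm_semiring_1 \<Rightarrow> 'm::{tomonoid,no_top} with_infinity"
  assumes v: "valuation v"
begin

lemma valuation_mult: "v (x * y) = v x + v y"
  and valuation_add: "min (v x) (v y) \<le> v (x + y)"
  and valuation_1: "v 1 = 0"
  and valuation_0: "v 0 = Infinity"
  using v by (auto simp: valuation_def)

lemma one_in_valuation_semiring: "1 \<in> valuation_semiring v"
  by (simp add: valuation_semiring_def valuation_1)

lemma one_notin_positive_ideal: "1 \<notin> positive_ideal v"
  by (simp add: positive_ideal_def valuation_1)

lemma ideal_above_ideal: "ideal_of (valuation_semiring v) (above_ideal v \<alpha>)"
  unfolding ideal_of_def
proof (intro conjI ballI)
  show "above_ideal v \<alpha> \<subseteq> valuation_semiring v"
    by (auto simp: above_ideal_def)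
  have "0 \<in> above_ideal v \<alpha>"
    by (simp add: above_ideal_def valuation_semiring_def valuation_0 Infinity_greatest
        Fin_less_Infinity)
  then show "above_ideal v \<alpha> \<noteq> {}"
    by blast
next
  fix a b
  assume "a \<in> above_ideal v \<alpha>" "b \<in> above_ideal v \<alpha>"
  then show "a + b \<in> above_ideal v \<alpha>"
    using valuation_add[of a b]
    by (auto simp: above_ideal_def valuation_semiring_def min_def split: if_splits)
next
  fix r a
  assume r: "r \<in> valuation_semiring v" and a: "a \<in> above_ideal v \<alpha>"
  have "v a \<le> v (r * a)"
    using r add_right_mono[of 0 "v r" "v a"]
    by (simp add: valuation_mult valuation_semiring_def)
  then show "r * a \<in> above_ideal v \<alpha>"
    using a by (auto simp: above_ideal_def valuation_semiring_def)
qed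

text \<open>
  Adding an element of value above \<open>\<alpha>\<close> does not change a value that is at most \<open>\<alpha>\<close>, so it
  cannot move an element from outside the ideal into it.
\<close>

lemma subtractive_above_ideal_if_min_property:
  assumes "min_property v"
  shows "subtractive_ideal_of (valuation_semiring v) (above_ideal v \<alpha>)"
  unfolding subtractive_ideal_of_def
proof (intro conjI ballI impI ideal_above_ideal)
  fix a b
  assume b: "b \<in> valuation_semiring v"
    and ab: "a + b \<in> above_ideal v \<alpha> \<and> a \<in> above_ideal v \<alpha>"
  have "Fin \<alpha> < v b"
  proof (rule ccontr)
    assume "\<not> Fin \<alpha> < v b"
    then have le: "v b \<le> Fin \<alpha>"
      by simp
    also have "Fin \<alpha> < v a"
      using ab by (simp add: above_ideal_def)
    finally have less: "v b < v a" .
    then have "v (a + b) = min (v a) (v b)"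
      using assms by (auto simp: min_property_def)
    also have "\<dots> = v b"
      using less by simp
    finally have "v (a + b) = v b" .
    with le ab show False
      by (auto simp: above_ideal_def)
  qed
  with b show "b \<in> above_ideal v \<alpha>"
    by (simp add: above_ideal_def)
qed

end

context
  fixes v :: "'k::semifield \<Rightarrow> 'm::{tomonoid,no_top} with_infinity"
  assumes v: "valuation v"
begin

lemma valuation_inverse:
  assumes "x \<noteq> 0"
  obtains u where "x * u = 1" "v x + v u = 0"
  using nonzero_invertible[OF assms] valuation_mult[OF v] valuation_1[OF v] by metis

text \<open>
  An element outside the positive ideal has value \<open>0\<close>; its inverse in the semifield then also
  has value \<open>0\<close>, so it is a unit of the valuation semiring itself.
\<close>

lemma proper_ideal_subset_positive_ideal:
  assumes J: "ideal_of (valuation_semiring v) J" and proper: "J \<noteq> valuation_semiring v"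
  shows "J \<subseteq> positive_ideal v"
proof (rule ccontr)
  assume "\<not> J \<subseteq> positive_ideal v"
  then obtain a where a: "a \<in> J" and not_pos: "a \<notin> positive_ideal v"
    by blast
  have "a \<in> valuation_semiring v"
    using J a by (auto simp: ideal_of_def)
  with not_pos have va: "v a = 0"
    by (auto simp: positive_ideal_def valuation_semiring_def)
  have "a \<noteq> 0"
    using va valuation_0[OF v] by (auto simp: zero_with_infinity_def)
  then obtain u where au: "a * u = 1" and vu: "v a + v u = 0"
    by (rule valuation_inverse)
  have "u \<in> valuation_semiring v"
    using va vu by (simp add: valuation_semiring_def)
  then have one: "1 \<in> J"
    using J a au unfolding ideal_of_def by (metis mult.commute)
  have "r \<in> J" if "r \<in> valuation_semiring v" for r
    using J one that unfolding ideal_of_def by (metis mult.right_neutral)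
  then have "J = valuation_semiring v"
    using J by (auto simp: ideal_of_def)
  with proper show False ..
qed

lemma maximal_ideal_iff_positive_ideal:
  "maximal_ideal_of (valuation_semiring v) Q \<longleftrightarrow> Q = positive_ideal v"
proof -
  have "ideal_of (valuation_semiring v) (positive_ideal v)"
    by (simp add: positive_ideal_eq_above_ideal_0 ideal_above_ideal[OF v])
  moreover have "positive_ideal v \<noteq> valuation_semiring v"
    using one_in_valuation_semiring[OF v] one_notin_positive_ideal[OF v] by blast
  ultimately show ?thesis
    using proper_ideal_subset_positive_ideal unfolding maximal_ideal_of_def by blast
qed

text \<open>
  Dividing by the summand \<open>x\<close> of smaller value reduces the claim to \<open>v (1 + z) = 0\<close> for
  \<open>v z > 0\<close>, the statement that no \<open>1 + z\<close> with \<open>z\<close> in the positive ideal lies in that ideal.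
\<close>

lemma min_property_if_subtractive_positive_ideal:
  assumes sub: "subtractive_ideal_of (valuation_semiring v) (positive_ideal v)"
  shows "min_property v"
proof -
  have eq: "v (x + y) = v x" if less: "v x < v y" for x y
  proof -
    have "x \<noteq> 0"
      using less Infinity_greatest[of "v y"] valuation_0[OF v] leD by metis
    then obtain u where xu: "x * u = 1" and vu: "v x + v u = 0"
      by (rule valuation_inverse)
    have "0 \<le> v (u * y)"
      using less add_left_mono[of "v x" "v y" "v u"] vu
      by (simp add: valuation_mult[OF v] add.commute)
    \<comment> \<open>Addition of values is only weakly monotone; strictness comes from cancelling the
      invertible value of \<open>x\<close>.\<close>
    moreover have "v (u * y) \<noteq> 0"
    proof
      assume "v (u * y) = 0"
      then have "v x + (v u + v y) = v x"
        by (simp add: valuation_mult[OF v])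
      then have "v y = v x"
        using vu by (simp flip: add.assoc)
      with less show False
        by simp
    qed
    ultimately have uy: "0 < v (u * y)"
      by simp
    have nonneg: "0 \<le> v (u * y + 1)"
      using valuation_add[OF v, of "u * y" 1] uy by (simp add: valuation_1[OF v] min_absorb2)
    have "u * y + 1 \<notin> positive_ideal v"
    proof
      assume "u * y + 1 \<in> positive_ideal v"
      moreover have "u * y \<in> positive_ideal v"
        using uy by (simp add: positive_ideal_def valuation_semiring_def)
      ultimately have "1 \<in> positive_ideal v"
        using sub one_in_valuation_semiring[OF v]
        unfolding subtractive_ideal_of_def ideal_of_def by blast
      with one_notin_positive_ideal[OF v] show False ..
    qed
    with nonneg have unit: "v (u * y + 1) = 0"
      by (auto simp: positive_ideal_def valuation_semiring_def)
    have "x + y = x * (u * y + 1)"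
      using xu by (simp add: distrib_left add.commute flip: mult.assoc)
    then show ?thesis
      by (simp add: valuation_mult[OF v] unit)
  qed
  show ?thesis
    unfolding min_property_def
  proof (intro allI impI)
    fix x y
    assume "v x \<noteq> v y"
    then consider "v x < v y" | "v y < v x"
      by (meson linorder_neqE)
    then show "v (x + y) = min (v x) (v y)"
      using eq[of x y] eq[of y x] by cases (simp_all add: add.commute min_def)
  qed
qed

end

theorem corollary2p15:
  fixes v :: "'k::semifield \<Rightarrow> 'm::{tomonoid,no_top} with_infinity"
    and T :: "'k set"
  assumes "V_semiring T v"
    and "surj v"
  shows "(\<forall>\<alpha>\<ge>0. ideal_of T (above_ideal v \<alpha>)) \<and>
    (\<forall>Q. maximal_ideal_of T Q \<longleftrightarrow> Q = positive_ideal v) \<and>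
    (min_property v \<longleftrightarrow> (\<forall>\<alpha>\<ge>0. subtractive_ideal_of T (above_ideal v \<alpha>))) \<and>
    (min_property v \<longleftrightarrow> subtractive_ideal_of T (positive_ideal v))"
proof -
  have v: "valuation v" and T: "T = valuation_semiring v"
    using assms(1) by (auto simp: V_semiring_def)
  have all: "subtractive_ideal_of T (above_ideal v \<alpha>)" if "min_property v" for \<alpha>
    using subtractive_above_ideal_if_min_property[OF v that] T by simp
  have converse: "min_property v" if "subtractive_ideal_of T (above_ideal v 0)"
    using min_property_if_subtractive_positive_ideal[OF v] that T
    by (simp add: positive_ideal_eq_above_ideal_0)
  show ?thesis
    using ideal_above_ideal[OF v] maximal_ideal_iff_positive_ideal[OF v] all converse
    unfolding T positive_ideal_eq_above_ideal_0 by blast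
qed

end
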